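(* Let $\Theta:(0,\infty)\to[1,\infty)$ be a nondecreasing function and let $\mathscr C\subset\mathcal M^\Theta_*$ be a class such that for every $r>0$ and every $\epsilon>0$ there exists a natural number $N=N(r,\epsilon)$ with $\mathrm{Cov}_{\overline{B^+_\star(r)}}(\epsilon)\le N(r,\epsilon)$ for all $(X,\star,d)\in\mathscr C$. Then $\mathscr C$ is pre-compact in the forward $\Theta$-Gromov-Hausdorff topology, i.e. every sequence in $\mathscr C$ has a subsequence converging to some element of $\mathcal M^\Theta_*$ in the forward $\Theta$-Gromov-Hausdorff topology.
   Context: An irreversible metric on $X$ is $d:X\times X\to[0,\infty)$ with $d(x,y)=0$ iff $x=y$ and $d(x,z)\le d(x,y)+d(y,z)$ (no symmetry). Forward balls are $B^+_x(r)=\{y:d(x,y)<r\}$; the topology is generated by the forward balls, and $\overline{B^+_x(r)}$ denotes the closure. For $A\subset X$, $\lambda_d(A)=\inf\{\lambda\ge1:d(x,y)\le\lambda\,d(y,x)\ \forall x,y\in A\}$. For a nondecreasing (not necessarily continuous) $\Theta$, $(X,\star,d)$ with $\star\in X$ is a pointed forward $\Theta$-metric space if $\lambda_d(\overline{B^+_\star(r)})\le\Theta(r)$ for every $r>0$. It is forward boundedly compact if every bounded closed forward ball is compact. $\mathcal M^\Theta_*$ is the collection of forward boundedly compact pointed forward $\Theta$-metric spaces. $\mathrm{Cov}_Y(\epsilon)$ is the minimum number of forward $\epsilon$-balls (of the metric space $Y$) needed to cover $Y$. For a map $f$ between such spaces, $\mathrm{dis} f=\sup_{x,x'}|d_Y(f(x),f(x'))-d_X(x,x')|$;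 for $A\subset X$, $A^\epsilon=\{x\in X:d(A,x)<\epsilon\}$ where $d(A,x)=\inf_{a\in A}d(a,x)$. A sequence $(X_i,\star_i,d_i)_i\subset\mathcal M^\Theta_*$ converges to $(X,\star,d)\in\mathcal M^\Theta_*$ in the forward $\Theta$-Gromov-Hausdorff topology if for every $r>0$ and $\epsilon>0$ there is $N=N(r,\epsilon)$ such that for every $i>N$ there is a (not necessarily continuous) map $f_i:\overline{B^+_{\star_i}(r)}\to X$ with $f_i(\star_i)=\star$, $\mathrm{dis} f_i\le\epsilon$ and $\overline{B^+_\star(r-\epsilon)}\subset[f_i(\overline{B^+_{\star_i}(r)})]^\epsilon$. *)

theory Defs
  imports "HOL-Analysis.Analysis"
begin

text \<open>
  Spaces are sets of points in an ambient type with a distance function that is only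
  relevant on that set; the distance is not assumed symmetric.
\<close>

definition irreversible_metric :: "'a set \<Rightarrow> ('a \<Rightarrow> 'a \<Rightarrow> real) \<Rightarrow> bool" where
  "irreversible_metric X d \<longleftrightarrow>
     (\<forall>x\<in>X. \<forall>y\<in>X. 0 \<le> d x y) \<and>
     (\<forall>x\<in>X. \<forall>y\<in>X. d x y = 0 \<longleftrightarrow> x = y) \<and>
     (\<forall>x\<in>X. \<forall>y\<in>X. \<forall>z\<in>X. d x z \<le> d x y + d y z)"

definition forward_ball :: "'a set \<Rightarrow> ('a \<Rightarrow> 'a \<Rightarrow> real) \<Rightarrow> 'a \<Rightarrow> real \<Rightarrow> 'a set" where
  "forward_ball X d x r = {y \<in> X. d x y < r}"

definition forward_topology :: "'a set \<Rightarrow> ('a \<Rightarrow> 'a \<Rightarrow> real) \<Rightarrow> 'a topology" where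
  "forward_topology X d = topology_generated_by {forward_ball X d x r | x r. x \<in> X \<and> 0 < r}"

text \<open>The topological closure of the forward ball, not the set of points \<open>y\<close> with \<open>d x y \<le> r\<close>.\<close>

definition closed_forward_ball :: "'a set \<Rightarrow> ('a \<Rightarrow> 'a \<Rightarrow> real) \<Rightarrow> 'a \<Rightarrow> real \<Rightarrow> 'a set" where
  "closed_forward_ball X d x r = forward_topology X d closure_of forward_ball X d x r"

text \<open>Extended-real valued, so that the infimum is \<open>\<infinity>\<close> if no admissible constant exists.\<close>

definition reversibility :: "('a \<Rightarrow> 'a \<Rightarrow> real) \<Rightarrow> 'a set \<Rightarrow> ereal" where
  "reversibility d A = (INF l\<in>{l::real. 1 \<le> l \<and> (\<forall>x\<in>A. \<forall>y\<in>A. d x y \<le> l * d y x)}. ereal l)"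

record 'a pointed_space =
  points :: "'a set"
  base :: 'a
  dst :: "'a \<Rightarrow> 'a \<Rightarrow> real"

abbreviation base_ball :: "'a pointed_space \<Rightarrow> real \<Rightarrow> 'a set" where
  "base_ball S r \<equiv> closed_forward_ball (points S) (dst S) (base S) r"

text \<open>Only the values of \<open>\<Theta>\<close> on the positive reals are used.\<close>

definition pointed_forward_metric_space :: "(real \<Rightarrow> real) \<Rightarrow> 'a pointed_space \<Rightarrow> bool" where
  "pointed_forward_metric_space \<Theta> S \<longleftrightarrow>
     irreversible_metric (points S) (dst S) \<and> base S \<in> points S \<and>
     (\<forall>r>0. reversibility (dst S) (base_ball S r) \<le> ereal (\<Theta> r))"

definition forward_boundedly_compact :: "'a set \<Rightarrow> ('a \<Rightarrow> 'a \<Rightarrow> real) \<Rightarrow> bool" where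
  "forward_boundedly_compact X d \<longleftrightarrow>
     (\<forall>x\<in>X. \<forall>r>0. compactin (forward_topology X d) (closed_forward_ball X d x r))"

definition forward_spaces :: "(real \<Rightarrow> real) \<Rightarrow> 'a pointed_space set" where
  "forward_spaces \<Theta> =
     {S. pointed_forward_metric_space \<Theta> S \<and> forward_boundedly_compact (points S) (dst S)}"

text \<open>The centres lie in \<open>Y\<close> itself; the value is \<open>\<infinity>\<close> if there is no finite cover.\<close>

definition covering_number :: "'a set \<Rightarrow> ('a \<Rightarrow> 'a \<Rightarrow> real) \<Rightarrow> real \<Rightarrow> enat" where
  "covering_number Y d \<epsilon> =
     (INF F\<in>{F. finite F \<and> F \<subseteq> Y \<and> Y \<subseteq> (\<Union>x\<in>F. forward_ball Y d x \<epsilon>)}. enat (card F))"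

definition distortion ::
  "'a set \<Rightarrow> ('a \<Rightarrow> 'a \<Rightarrow> real) \<Rightarrow> ('b \<Rightarrow> 'b \<Rightarrow> real) \<Rightarrow> ('a \<Rightarrow> 'b) \<Rightarrow> ereal" where
  "distortion A dX dY f = (SUP (x, x')\<in>A \<times> A. ereal \<bar>dY (f x) (f x') - dX x x'\<bar>)"

definition forward_neighbourhood ::
  "'a set \<Rightarrow> ('a \<Rightarrow> 'a \<Rightarrow> real) \<Rightarrow> 'a set \<Rightarrow> real \<Rightarrow> 'a set" where
  "forward_neighbourhood X d A \<epsilon> = {x \<in> X. (INF a\<in>A. ereal (d a x)) < ereal \<epsilon>}"

text \<open>
  The ambient types of the sequence and of the limit may differ. For \<open>r \<le> \<epsilon>\<close> the ball of
  radius \<open>r - \<epsilon>\<close> is empty, so the last inclusion is void.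
\<close>

definition forward_GH_converges ::
  "(real \<Rightarrow> real) \<Rightarrow> (nat \<Rightarrow> 'a pointed_space) \<Rightarrow> 'b pointed_space \<Rightarrow> bool" where
  "forward_GH_converges \<Theta> S L \<longleftrightarrow>
     (\<forall>i. S i \<in> forward_spaces \<Theta>) \<and> L \<in> forward_spaces \<Theta> \<and>
     (\<forall>r>0. \<forall>\<epsilon>>0. \<exists>N::nat. \<forall>i>N. \<exists>f \<in> base_ball (S i) r \<rightarrow> points L.
        f (base (S i)) = base L \<and>
        distortion (base_ball (S i) r) (dst (S i)) (dst L) f \<le> ereal \<epsilon> \<and>
        base_ball L (r - \<epsilon>) \<subseteq>
          forward_neighbourhood (points L) (dst L) (f ` base_ball (S i) r) \<epsilon>)"

text \<open>
  Pre-compactness in the sense of subsequences. The limit space is sought on a subset of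
  \<open>real\<close>: the class may live on an arbitrary (possibly countable) ambient type, which can be
  too small to carry the limit, whereas every forward boundedly compact pointed forward
  \<open>\<Theta>\<close>-metric space is separable, hence has at most the cardinality of the continuum and an
  isometric copy of it lives on a subset of \<open>real\<close>.
\<close>

definition forward_GH_precompact :: "(real \<Rightarrow> real) \<Rightarrow> 'a pointed_space set \<Rightarrow> bool" where
  "forward_GH_precompact \<Theta> \<C> \<longleftrightarrow>
     (\<forall>S::nat \<Rightarrow> 'a pointed_space. (\<forall>i. S i \<in> \<C>) \<longrightarrow>
        (\<exists>\<phi>::nat \<Rightarrow> nat. \<exists>L::real pointed_space.
           strict_mono \<phi> \<and> L \<in> forward_spaces \<Theta> \<and> forward_GH_converges \<Theta> (S \<circ> \<phi>) L))"

end

theory Submission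
  imports Defs "HOL-Complex_Analysis.Great_Picard"
begin

text \<open>
  The covering bounds provide in each space \<open>S i\<close> a sequence of points \<open>y i k\<close>, starting at
  the base point, that contains finite nets of all bounded balls, of sizes independent of \<open>i\<close>.
  After a diagonal extraction the distances \<open>d (y i k) (y i l)\<close> converge to some \<open>\<delta> k l\<close>, and
  the limit space is the completion of \<open>\<nat>\<close> with respect to \<open>\<delta>\<close>. It is obtained by a
  one-sided Kuratowski embedding: \<open>k\<close> becomes the bounded function \<open>\<lambda>m. \<delta> m k - \<delta> m 0\<close>, the
  completion is the closure of these functions in the supremum norm, and the distance is
  \<open>D f g = (SUP m. g m - f m)\<close>. On bounded sets the reversibility bound makes \<open>D\<close> comparable
  to the supremum distance, so that total boundedness gives compactness of bounded balls; it
  also shows that \<open>\<lambda>\<close> of a ball equals \<open>\<lambda>\<close> of its closure, so the possible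
  discontinuity of \<open>\<Theta>\<close> does no harm.
\<close>

section \<open>Forward topology and reversibility\<close>

lemma generate_topology_forward_ball:
  assumes "irreversible_metric X d"
    and "generate_topology_on {forward_ball X d x r | x r. x \<in> X \<and> 0 < r} U"
  shows "U \<subseteq> X \<and> (\<forall>x\<in>U. \<exists>e>0. forward_ball X d x e \<subseteq> U)"
  using assms(2)
proof induction
  case (Int U V)
  have "\<exists>e>0. forward_ball X d x e \<subseteq> U \<inter> V" if x: "x \<in> U \<inter> V" for x
  proof -
    obtain e1 e2 where "e1 > 0" "forward_ball X d x e1 \<subseteq> U" "e2 > 0" "forward_ball X d x e2 \<subseteq> V"
      using Int x by (meson IntD1 IntD2)
    then show ?thesis
      by (intro exI[of _ "min e1 e2"]) (auto simp: forward_ball_def)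
  qed
  then show ?case using Int by blast
next
  case (UN K)
  then show ?case by (meson Union_iff Union_least Union_upper subset_trans)
next
  case (Basis B)
  then obtain x r where B: "B = forward_ball X d x r" "x \<in> X" "r > 0" by auto
  \<comment> \<open>The triangle inequality through \<open>y\<close> runs in the direction in which
    forward balls measure, so the usual smaller ball around \<open>y\<close> works without reversing
    any distance.\<close>
  have "forward_ball X d y (r - d x y) \<subseteq> B" if "y \<in> B" for y
  proof
    fix z assume "z \<in> forward_ball X d y (r - d x y)"
    moreover have "d x z \<le> d x y + d y z" if "z \<in> X"
      using assms(1) B that \<open>y \<in> B\<close> by (auto simp: irreversible_metric_def forward_ball_def)
    ultimately show "z \<in> B" by (auto simp: B forward_ball_def)
  qed
  then show ?case
    using B by (auto simp: forward_ball_def intro!: exI[of _ "r - d x _"])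
qed auto

lemma centre_in_forward_ball:
  "irreversible_metric X d \<Longrightarrow> x \<in> X \<Longrightarrow> 0 < e \<Longrightarrow> x \<in> forward_ball X d x e"
proof -
  assume "irreversible_metric X d" and x: "x \<in> X" and "0 < e"
  then have "d x x = 0" by (simp add: irreversible_metric_def)
  with x \<open>0 < e\<close> show ?thesis by (simp add: forward_ball_def)
qed

text \<open>Forward balls, a priori only a subbase, are in fact a base, so openness can be tested
  with balls centred at the points of the set.\<close>

lemma openin_forward_topology:
  assumes "irreversible_metric X d"
  shows "openin (forward_topology X d) U \<longleftrightarrow>
    U \<subseteq> X \<and> (\<forall>x\<in>U. \<exists>e>0. forward_ball X d x e \<subseteq> U)"
proof
  assume "openin (forward_topology X d) U"
  then show "U \<subseteq> X \<and> (\<forall>x\<in>U. \<exists>e>0. forward_ball X d x e \<subseteq> U)"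
    using generate_topology_forward_ball[OF assms]
    by (simp add: forward_topology_def openin_topology_generated_by_iff)
next
  assume U: "U \<subseteq> X \<and> (\<forall>x\<in>U. \<exists>e>0. forward_ball X d x e \<subseteq> U)"
  show "openin (forward_topology X d) U"
  proof (subst openin_subopen, intro ballI)
    fix x assume x: "x \<in> U"
    then obtain e where e: "e > 0" "forward_ball X d x e \<subseteq> U" using U by blast
    have "openin (forward_topology X d) (forward_ball X d x e)"
      unfolding forward_topology_def using x U e(1)
      by (intro topology_generated_by_Basis) blast
    moreover have "x \<in> forward_ball X d x e"
      using x U e(1) by (intro centre_in_forward_ball assms) auto
    ultimately show "\<exists>T. openin (forward_topology X d) T \<and> x \<in> T \<and> T \<subseteq> U"
      using e by blast
  qed
qed

lemma topspace_forward_topology: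
  assumes "irreversible_metric X d"
  shows "topspace (forward_topology X d) = X"
proof
  show "topspace (forward_topology X d) \<subseteq> X"
    by (metis assms openin_forward_topology openin_topspace)
  have "openin (forward_topology X d) X"
    using openin_forward_topology[OF assms] by (auto simp: forward_ball_def intro: exI[of _ 1])
  then show "X \<subseteq> topspace (forward_topology X d)" by (rule openin_subset)
qed

text \<open>Basic neighbourhoods of \<open>z\<close> are forward balls centred at \<open>z\<close>;
  hence the approximating point is measured from \<open>z\<close>, as \<open>d z y < e\<close> and
  not \<open>d y z < e\<close>.\<close>

lemma mem_closed_forward_ball_iff:
  assumes "irreversible_metric X d"
  shows "z \<in> closed_forward_ball X d x r \<longleftrightarrow> z \<in> X \<and> (\<forall>e>0. \<exists>y\<in>X. d x y < r \<and> d z y < e)"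
proof
  have open_ball: "openin (forward_topology X d) (forward_ball X d z e)" if "z \<in> X" "e > 0" for e
    unfolding forward_topology_def using that by (intro topology_generated_by_Basis) blast
  note centre = centre_in_forward_ball[OF assms]
  assume z: "z \<in> closed_forward_ball X d x r"
  then have zX: "z \<in> X"
    using topspace_forward_topology[OF assms] by (simp add: closed_forward_ball_def in_closure_of)
  have "\<exists>y\<in>X. d x y < r \<and> d z y < e" if "e > 0" for e
  proof -
    from z have "\<exists>y. y \<in> forward_ball X d x r \<and> y \<in> forward_ball X d z e"
      unfolding closed_forward_ball_def in_closure_of
      using open_ball[OF zX that] centre[OF zX that] by blast
    then show ?thesis by (auto simp: forward_ball_def)
  qed
  with zX show "z \<in> X \<and> (\<forall>e>0. \<exists>y\<in>X. d x y < r \<and> d z y < e)" by blast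
next
  assume z: "z \<in> X \<and> (\<forall>e>0. \<exists>y\<in>X. d x y < r \<and> d z y < e)"
  then have "z \<in> topspace (forward_topology X d)"
    by (simp add: topspace_forward_topology[OF assms])
  moreover have "\<exists>y. y \<in> forward_ball X d x r \<and> y \<in> T"
    if T: "z \<in> T" "openin (forward_topology X d) T" for T
  proof -
    obtain e where "e > 0" "forward_ball X d z e \<subseteq> T"
      using T openin_forward_topology[OF assms, of T] by blast
    moreover obtain y where "y \<in> X" "d x y < r" "d z y < e"
      using z \<open>e > 0\<close> by blast
    ultimately show ?thesis by (intro exI[of _ y]) (auto simp: forward_ball_def)
  qed
  ultimately show "z \<in> closed_forward_ball X d x r"
    by (auto simp: closed_forward_ball_def in_closure_of)
qed

lemma closed_forward_ball_superset:
  assumes "irreversible_metric X d" "y \<in> X" "d x y < r"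
  shows "y \<in> closed_forward_ball X d x r"
  unfolding mem_closed_forward_ball_iff[OF assms(1)]
  using centre_in_forward_ball[OF assms(1,2)] assms(2,3) by (auto simp: forward_ball_def)

text \<open>A bound on the infimum is itself an admissible constant: every \<open>u > t\<close>
  exceeds an admissible one, hence is admissible by nonnegativity, and \<open>u\<close> may decrease
  to \<open>t\<close>.\<close>

lemma reversibility_le_iff:
  assumes "\<And>x y. x \<in> A \<Longrightarrow> y \<in> A \<Longrightarrow> 0 \<le> d x y" and "1 \<le> t"
  shows "reversibility d A \<le> ereal t \<longleftrightarrow> (\<forall>x\<in>A. \<forall>y\<in>A. d x y \<le> t * d y x)"
proof
  assume L: "reversibility d A \<le> ereal t"
  show "\<forall>x\<in>A. \<forall>y\<in>A. d x y \<le> t * d y x"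
  proof (intro ballI)
    fix x y assume xy: "x \<in> A" "y \<in> A"
    have bound: "d x y \<le> u * d y x" if "u > t" for u
    proof -
      have "reversibility d A < ereal u" using L that by (simp add: le_less_trans)
      then obtain l where "l < u" "d x y \<le> l * d y x"
        using xy by (auto simp: reversibility_def INF_less_iff)
      moreover have "l * d y x \<le> u * d y x"
        using \<open>l < u\<close> assms(1)[of y x] xy by (intro mult_right_mono) auto
      ultimately show ?thesis by linarith
    qed
    have "((\<lambda>u. u * d y x) \<longlongrightarrow> t * d y x) (at_right t)"
      by (intro tendsto_intros)
    then show "d x y \<le> t * d y x"
      by (rule tendsto_lowerbound) (auto simp: eventually_at_right_less bound
          intro: eventually_mono[OF eventually_at_right_less])
  qed
next
  assume "\<forall>x\<in>A. \<forall>y\<in>A. d x y \<le> t * d y x"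
  then show "reversibility d A \<le> ereal t"
    unfolding reversibility_def using assms(2) by (intro INF_lower) auto
qed

text \<open>The bound is required on open base balls only. In this form it passes to limits and
  completions, because strict inequalities survive small perturbations;
  \<open>reversibility_base_ball\<close> recovers the closed balls.\<close>

locale locally_reversible =
  fixes X :: "'a set" and d :: "'a \<Rightarrow> 'a \<Rightarrow> real" and b :: 'a and \<Theta> :: "real \<Rightarrow> real"
  assumes irrev: "irreversible_metric X d" and base_in: "b \<in> X"
    and Theta: "0 < r \<Longrightarrow> 1 \<le> \<Theta> r"
    and rev: "\<lbrakk>0 < r; x \<in> X; y \<in> X; d b x < r; d b y < r\<rbrakk> \<Longrightarrow> d x y \<le> \<Theta> r * d y x"
begin

lemma nonneg: "x \<in> X \<Longrightarrow> y \<in> X \<Longrightarrow> 0 \<le> d x y"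
  and eq_0_iff: "x \<in> X \<Longrightarrow> y \<in> X \<Longrightarrow> d x y = 0 \<longleftrightarrow> x = y"
  and triangle: "x \<in> X \<Longrightarrow> y \<in> X \<Longrightarrow> z \<in> X \<Longrightarrow> d x z \<le> d x y + d y z"
  using irrev by (auto simp: irreversible_metric_def)

lemma dist_self: "x \<in> X \<Longrightarrow> d x x = 0"
  using eq_0_iff by blast

text \<open>All points at forward distance below 1 from \<open>x\<close> lie in the base ball of
  radius \<open>d b x + 1\<close>, where the single constant \<open>\<Theta> R\<close> controls
  backward distances.\<close>

lemma backward_close:
  assumes "x \<in> X" "0 < e"
  obtains s where "0 < s" "s \<le> e" "\<And>y. y \<in> X \<Longrightarrow> d x y < s \<Longrightarrow> d y x < e"
proof -
  define R where "R = d b x + 1"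
  have R: "R > 0" "1 \<le> \<Theta> R" using nonneg[OF base_in assms(1)] Theta[of R] by (auto simp: R_def)
  show thesis
  proof
    show "0 < min 1 (e / \<Theta> R)" using R assms by simp
    have "e / \<Theta> R \<le> e / 1"
      using R assms by (intro divide_left_mono) auto
    then show "min 1 (e / \<Theta> R) \<le> e" by auto
    fix y assume y: "y \<in> X" "d x y < min 1 (e / \<Theta> R)"
    have "d b y < R" using triangle[OF base_in assms(1) y(1)] y(2) by (simp add: R_def)
    then have "d y x \<le> \<Theta> R * d x y" using rev[of R y x] R y assms by (simp add: R_def)
    also have "\<dots> < \<Theta> R * (e / \<Theta> R)" using y R by (intro mult_strict_left_mono) auto
    finally show "d y x < e" using R by simp
  qed
qed

section \<open>Closed forward balls and their reversibility\<close>

lemma closed_ball_approx: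
  assumes "x \<in> X" "z \<in> closed_forward_ball X d x r" "0 < e"
  obtains y where "y \<in> X" "d x y < r" "d z y < e" "d y z < e"
proof -
  have z: "z \<in> X" using assms mem_closed_forward_ball_iff[OF irrev] by metis
  obtain s where s: "0 < s" "s \<le> e" "\<And>y. y \<in> X \<Longrightarrow> d z y < s \<Longrightarrow> d y z < e"
    using backward_close[OF z assms(3)] by blast
  then obtain y where "y \<in> X" "d x y < r" "d z y < s"
    using assms mem_closed_forward_ball_iff[OF irrev] by metis
  then show thesis using s that by force
qed

lemma closed_ball_subset: "closed_forward_ball X d x r \<subseteq> X"
  using mem_closed_forward_ball_iff[OF irrev] by blast

lemma closed_ball_le:
  assumes "x \<in> X" "z \<in> closed_forward_ball X d x r"
  shows "d x z \<le> r"
proof (rule field_le_epsilon)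
  fix e :: real assume "e > 0"
  then obtain y where "y \<in> X" "d x y < r" "d z y < e" "d y z < e"
    using closed_ball_approx[OF assms] by blast
  then show "d x z \<le> r + e"
    using triangle[of x y z] assms closed_ball_subset by force
qed

text \<open>Both points are approximated, in both directions, by points of the open ball, where the
  bound already holds with the constant \<open>\<Theta> r\<close>. No value of
  \<open>\<Theta>\<close> at a larger radius enters.\<close>

lemma reversibility_base_ball:
  assumes "0 < r"
  shows "reversibility d (closed_forward_ball X d b r) \<le> ereal (\<Theta> r)"
proof -
  let ?B = "closed_forward_ball X d b r"
  have "d x y \<le> \<Theta> r * d y x" if xy: "x \<in> ?B" "y \<in> ?B" for x y
  proof (rule field_le_epsilon)
    fix e :: real assume e: "e > 0"
    have \<Theta>: "1 \<le> \<Theta> r" using Theta assms .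
    \<comment> \<open>Passing to the approximating points costs \<open>2 * s\<close> for
      \<open>d x y\<close> and \<open>2 * s\<close> inside the factor of \<open>\<Theta> r\<close>,
      in total \<open>e\<close>.\<close>
    define s where "s = e / (2 + 2 * \<Theta> r)"
    have s: "s > 0" using e \<Theta> by (simp add: s_def)
    have in_X: "x \<in> X" "y \<in> X" using xy closed_ball_subset by auto
    obtain x' where x': "x' \<in> X" "d b x' < r" "d x x' < s" "d x' x < s"
      using closed_ball_approx[OF base_in xy(1) s] .
    obtain y' where y': "y' \<in> X" "d b y' < r" "d y y' < s" "d y' y < s"
      using closed_ball_approx[OF base_in xy(2) s] .
    have "d x y \<le> d x x' + d x' y' + d y' y"
      using triangle[of x x' y] triangle[of x' y' y] in_X x' y' by linarith
    also have "\<dots> \<le> 2 * s + \<Theta> r * d y' x'"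
      using rev[of r x' y'] assms x' y' by linarith
    also have "\<dots> \<le> 2 * s + \<Theta> r * (d y x + 2 * s)"
      using triangle[of y' y x'] triangle[of y x x'] in_X x' y' \<Theta>
      by (intro add_left_mono mult_left_mono) auto
    also have "\<dots> = \<Theta> r * d y x + (2 + 2 * \<Theta> r) * s" by (simp add: algebra_simps)
    also have "\<dots> = \<Theta> r * d y x + e" using \<Theta> by (simp add: s_def)
    finally show "d x y \<le> \<Theta> r * d y x + e" .
  qed
  then show ?thesis
    using nonneg closed_ball_subset Theta[OF assms] by (subst reversibility_le_iff) blast+
qed

text \<open>The absolute values change nothing on \<open>X\<close>; they give nonnegativity on the
  whole type, as \<open>Metric_space\<close> demands.\<close>

definition sym_dist :: "'a \<Rightarrow> 'a \<Rightarrow> real" where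
  "sym_dist x y = \<bar>d x y\<bar> + \<bar>d y x\<bar>"

lemma sym_dist_eq: "x \<in> X \<Longrightarrow> y \<in> X \<Longrightarrow> sym_dist x y = d x y + d y x"
  by (simp add: sym_dist_def nonneg)

sublocale Sym: Metric_space X sym_dist
proof
  show "sym_dist x y = 0 \<longleftrightarrow> x = y" if "x \<in> X" "y \<in> X" for x y
    using that eq_0_iff[of x y] eq_0_iff[of y x] by (auto simp: sym_dist_def)
  show "sym_dist x z \<le> sym_dist x y + sym_dist y z" if "x \<in> X" "y \<in> X" "z \<in> X" for x y z
    using that triangle[of x y z] triangle[of z y x] by (simp add: sym_dist_eq)
qed (auto simp: sym_dist_def)

text \<open>A symmetric ball lies in the forward ball of the same radius, and
  \<open>backward_close\<close> gives the converse at a smaller radius. Metrizability makes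
  sequential arguments available for compactness.\<close>

lemma forward_topology_eq: "forward_topology X d = Sym.mtopology"
proof -
  have "(\<exists>e>0. forward_ball X d x e \<subseteq> U) \<longleftrightarrow> (\<exists>e>0. Sym.mball x e \<subseteq> U)" if x: "x \<in> X" for x U
  proof
    assume "\<exists>e>0. forward_ball X d x e \<subseteq> U"
    then obtain e where e: "e > 0" "forward_ball X d x e \<subseteq> U" by blast
    have "Sym.mball x e \<subseteq> forward_ball X d x e"
    proof
      fix y assume "y \<in> Sym.mball x e"
      then show "y \<in> forward_ball X d x e"
        using nonneg[of y x] by (auto simp: forward_ball_def sym_dist_eq)
    qed
    with e show "\<exists>e>0. Sym.mball x e \<subseteq> U" by blast
  next
    assume "\<exists>e>0. Sym.mball x e \<subseteq> U"
    then obtain e where e: "e > 0" "Sym.mball x e \<subseteq> U" by blast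
    obtain s where s: "0 < s" "s \<le> e / 2" "\<And>y. y \<in> X \<Longrightarrow> d x y < s \<Longrightarrow> d y x < e / 2"
      using backward_close[OF x, of "e / 2"] e by auto
    have "forward_ball X d x s \<subseteq> Sym.mball x e"
      using s x by (fastforce simp: forward_ball_def sym_dist_eq)
    with e s show "\<exists>e>0. forward_ball X d x e \<subseteq> U" by blast
  qed
  then show ?thesis
    unfolding topology_eq openin_forward_topology[OF irrev] Sym.openin_mtopology by blast
qed

text \<open>A ball about any centre is bounded as seen from \<open>b\<close>, so sequences bounded
  from the base point suffice; closedness of the ball keeps the limit inside.\<close>

lemma forward_boundedly_compactI:
  assumes "\<And>R \<sigma>. (\<And>n::nat. \<sigma> n \<in> X \<and> d b (\<sigma> n) \<le> R) \<Longrightarrow>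
     \<exists>x\<in>X. \<exists>k. strict_mono (k::nat \<Rightarrow> nat) \<and> (\<lambda>n. sym_dist (\<sigma> (k n)) x) \<longlonglongrightarrow> 0"
  shows "forward_boundedly_compact X d"
  unfolding forward_boundedly_compact_def
proof (intro ballI allI impI)
  fix x and r :: real assume x: "x \<in> X" and "r > 0"
  let ?B = "closed_forward_ball X d x r"
  have closed: "closedin Sym.mtopology ?B"
    by (simp add: closed_forward_ball_def forward_topology_eq)
  have "compactin Sym.mtopology ?B"
    unfolding Sym.compactin_sequentially
  proof (intro conjI allI impI closed_ball_subset)
    fix \<sigma> :: "nat \<Rightarrow> 'a" assume \<sigma>: "range \<sigma> \<subseteq> ?B"
    then have \<sigma>X: "\<sigma> n \<in> X" and \<sigma>r: "d x (\<sigma> n) \<le> r" for n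
      using closed_ball_subset closed_ball_le[OF x] by blast+
    have "d b (\<sigma> n) \<le> d b x + r" for n
      using triangle[OF base_in x \<sigma>X] \<sigma>r by (meson add_left_mono order_trans)
    then obtain l k where l: "l \<in> X" "strict_mono (k::nat \<Rightarrow> nat)"
      "(\<lambda>n. sym_dist (\<sigma> (k n)) l) \<longlonglongrightarrow> 0"
      using assms[of \<sigma> "d b x + r"] \<sigma>X by blast
    have lim: "limitin Sym.mtopology (\<sigma> \<circ> k) l sequentially"
      using l \<sigma>X by (simp add: Sym.limitin_metric_dist_null)
    moreover have "range (\<sigma> \<circ> k) \<subseteq> ?B" using \<sigma> by auto
    then have "l \<in> ?B"
      using closed lim unfolding Sym.metric_closedin_iff_sequentially_closed by blast
    ultimately show "\<exists>l r. l \<in> ?B \<and> strict_mono r \<and> limitin Sym.mtopology (\<sigma> \<circ> r) l sequentially"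
      using l by blast
  qed
  then show "compactin (forward_topology X d) ?B" by (simp add: forward_topology_eq)
qed

end

lemma forward_spaces_locally_reversible:
  assumes "S \<in> forward_spaces \<Theta>" and "\<And>r. 0 < r \<Longrightarrow> 1 \<le> \<Theta> r"
  shows "locally_reversible (points S) (dst S) (base S) \<Theta>"
proof -
  from assms(1) have S: "irreversible_metric (points S) (dst S)" "base S \<in> points S"
    and rev: "\<And>r. 0 < r \<Longrightarrow> reversibility (dst S) (base_ball S r) \<le> ereal (\<Theta> r)"
    by (auto simp: forward_spaces_def pointed_forward_metric_space_def)
  have in_ball: "x \<in> base_ball S r" if "x \<in> points S" "dst S (base S) x < r" for x r
    by (intro closed_forward_ball_superset S(1) that)
  show ?thesis
  proof
    fix r x y
    assume "0 < r" "x \<in> points S" "y \<in> points S" "dst S (base S) x < r" "dst S (base S) y < r"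
    moreover have "\<forall>x\<in>base_ball S r. \<forall>y\<in>base_ball S r. dst S x y \<le> \<Theta> r * dst S y x"
    proof (rule reversibility_le_iff[THEN iffD1])
      fix x y assume "x \<in> base_ball S r" "y \<in> base_ball S r"
      then have "x \<in> points S" "y \<in> points S"
        by (simp_all add: mem_closed_forward_ball_iff[OF S(1)])
      then show "0 \<le> dst S x y" using S(1) by (simp add: irreversible_metric_def)
    qed (use assms(2) rev \<open>0 < r\<close> in auto)
    ultimately show "dst S x y \<le> \<Theta> r * dst S y x" using in_ball by blast
  qed (use S assms in auto)
qed

section \<open>Completion of a limit distance on the natural numbers\<close>

lemma complete_UNIV_bcontfun: "complete (UNIV :: ('a::topological_space \<Rightarrow>\<^sub>C 'b::complete_space) set)"
proof (rule completeI)
  fix f :: "nat \<Rightarrow> 'a \<Rightarrow>\<^sub>C 'b" assume "Cauchy f"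
  then have "uniformly_Cauchy_on UNIV (\<lambda>n. apply_bcontfun (f n))"
    unfolding Cauchy_def uniformly_Cauchy_on_def by (meson dist_fun_lt_imp_dist_val_lt)
  then obtain g where "uniform_limit UNIV (\<lambda>n. apply_bcontfun (f n)) g sequentially"
    using Cauchy_uniformly_convergent uniformly_convergent_on_def by blast
  then show "\<exists>l\<in>UNIV. f \<longlonglongrightarrow> l"
    by (rule uniform_limit_bcontfunE) auto
qed

text \<open>A function is determined by the set of pairs \<open>(m, q)\<close> with \<open>q\<close>
  rational and below its value at \<open>m\<close>, and sets of naturals inject into the reals. This
  allows the limit space to be placed inside \<open>real\<close>.\<close>

lemma inj_bcontfun_real_exists: "\<exists>h :: (nat \<Rightarrow>\<^sub>C real) \<Rightarrow> real. inj h"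
proof -
  obtain g :: "nat set \<Rightarrow> real" where g: "inj g"
    using nat_sets_eqpoll_reals by (auto simp: eqpoll_def bij_betw_def)
  define c where "c f = {n. (case from_nat n :: nat \<times> rat of (m, q) \<Rightarrow> of_rat q < apply_bcontfun f m)}"
    for f :: "nat \<Rightarrow>\<^sub>C real"
  have "inj c"
  proof
    fix f1 f2 assume eq: "c f1 = c f2"
    have iff: "of_rat q < apply_bcontfun f1 m \<longleftrightarrow> of_rat q < apply_bcontfun f2 m" for m and q :: rat
    proof -
      have "to_nat (m, q) \<in> c f1 \<longleftrightarrow> to_nat (m, q) \<in> c f2" using eq by simp
      then show ?thesis by (simp add: c_def)
    qed
    have "apply_bcontfun f1 m = apply_bcontfun f2 m" for m
      using iff of_rat_dense by (metis linorder_less_linear not_less_iff_gr_or_eq)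
    then show "f1 = f2" by (rule bcontfun_eqI)
  qed
  then have "inj (g \<circ> c)" using g by (simp add: inj_compose)
  then show ?thesis by blast
qed

text \<open>The role of \<open>\<delta>\<close> is that of the limiting distances between net
  points, so it may vanish between distinct indices. By \<open>nets\<close>, finitely many initial
  indices form a two-sided net of each ball.\<close>

locale quasi_pseudo_metric_nets =
  fixes \<delta> :: "nat \<Rightarrow> nat \<Rightarrow> real" and \<Theta> :: "real \<Rightarrow> real"
  assumes nonneg: "0 \<le> \<delta> k l"
    and self: "\<delta> k k = 0"
    and triangle: "\<delta> k m \<le> \<delta> k l + \<delta> l m"
    and Theta: "0 < r \<Longrightarrow> 1 \<le> \<Theta> r"
    and rev: "\<lbrakk>0 < r; \<delta> 0 k < r; \<delta> 0 l < r\<rbrakk> \<Longrightarrow> \<delta> k l \<le> \<Theta> r * \<delta> l k"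
    and nets: "0 < r \<Longrightarrow> 0 < e \<Longrightarrow> \<exists>M. \<forall>k. \<delta> 0 k < r \<longrightarrow> (\<exists>l<M. \<delta> k l < e \<and> \<delta> l k < e)"
begin

text \<open>The term \<open>\<delta> m 0\<close> makes the function bounded, by
  \<open>\<delta> 0 k + \<delta> k 0\<close>, and cancels in differences of two such
  functions.\<close>

definition emb :: "nat \<Rightarrow> (nat \<Rightarrow>\<^sub>C real)" where
  "emb k = Bcontfun (\<lambda>m. \<delta> m k - \<delta> m 0)"

lemma emb_apply: "apply_bcontfun (emb k) m = \<delta> m k - \<delta> m 0"
proof -
  have "(\<lambda>m. \<delta> m k - \<delta> m 0) \<in> bcontfun"
  proof (rule bcontfun_normI)
    show "norm (\<delta> m k - \<delta> m 0) \<le> \<delta> 0 k + \<delta> k 0" for m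
      using triangle[of m k 0] triangle[of m 0 k] nonneg[of 0 k] nonneg[of k 0]
      by (simp add: abs_le_iff)
  qed simp
  then show ?thesis by (simp add: emb_def Bcontfun_inverse)
qed

text \<open>
  The triangle inequality gives \<open>\<delta> k l = (SUP m. \<delta> m l - \<delta> m k)\<close>, so this one-sided
  supremum distance extends \<open>\<delta>\<close>.
\<close>

definition D :: "(nat \<Rightarrow>\<^sub>C real) \<Rightarrow> (nat \<Rightarrow>\<^sub>C real) \<Rightarrow> real" where
  "D f g = (SUP m. apply_bcontfun g m - apply_bcontfun f m)"

section \<open>Estimates for the one-sided supremum distance\<close>

lemma apply_diff_le_dist: "apply_bcontfun g m - apply_bcontfun f m \<le> dist f g"
  using dist_bounded[of f m g] by (simp add: dist_real_def abs_le_iff)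

lemma apply_diff_le_D: "apply_bcontfun g m - apply_bcontfun f m \<le> D f g"
  unfolding D_def by (rule cSUP_upper) (auto intro!: bdd_aboveI2 apply_diff_le_dist)

lemma D_leI: "(\<And>m. apply_bcontfun g m - apply_bcontfun f m \<le> c) \<Longrightarrow> D f g \<le> c"
  unfolding D_def by (rule cSUP_least) auto

lemma D_le_dist: "D f g \<le> dist f g"
  by (rule D_leI) (rule apply_diff_le_dist)

lemma D_self: "D f f = 0"
  by (simp add: D_def)

lemma D_triangle: "D f h \<le> D f g + D g h"
proof (rule D_leI)
  fix m show "apply_bcontfun h m - apply_bcontfun f m \<le> D f g + D g h"
    using apply_diff_le_D[of g m f] apply_diff_le_D[of h m g] by linarith
qed

text \<open>With \<open>D_le_dist\<close> this shows that the supremum distance is exactly the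
  larger of the two one-sided ones.\<close>

lemma dist_le_D: "dist f g \<le> max (D f g) (D g f)"
proof (rule dist_bound)
  fix m show "dist (apply_bcontfun f m) (apply_bcontfun g m) \<le> max (D f g) (D g f)"
    using apply_diff_le_D[of g m f] apply_diff_le_D[of f m g] by (auto simp: dist_real_def)
qed

text \<open>The supremum is attained at \<open>m = k\<close>, where the difference is
  \<open>\<delta> k l - \<delta> k k\<close>.\<close>

lemma D_emb: "D (emb k) (emb l) = \<delta> k l"
proof (rule antisym)
  show "D (emb k) (emb l) \<le> \<delta> k l"
    using triangle[of _ l k] by (intro D_leI) (simp add: emb_apply algebra_simps)
  show "\<delta> k l \<le> D (emb k) (emb l)"
    using apply_diff_le_D[of "emb l" k "emb k"] by (simp add: emb_apply self)
qed

section \<open>The completion and the extension of the estimates to it\<close>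

definition Y :: "(nat \<Rightarrow>\<^sub>C real) set" where
  "Y = closure (range emb)"

lemma emb_in_Y: "emb k \<in> Y"
  unfolding Y_def by (rule subsetD[OF closure_subset]) simp

lemma Y_approx:
  assumes "f \<in> Y" "0 < e"
  obtains k where "D f (emb k) < e" "D (emb k) f < e"
proof -
  obtain k where "dist (emb k) f < e"
    using assms by (auto simp: Y_def closure_approachable)
  then show thesis
    using D_le_dist[of f "emb k"] D_le_dist[of "emb k" f] that[of k] by (simp add: dist_commute)
qed

text \<open>On arbitrary functions \<open>D\<close> can be negative, for instance from
  \<open>f\<close> to \<open>f - 1\<close>; on \<open>Y\<close> the sign is inherited from
  \<open>\<delta>\<close> by approximation.\<close>

lemma D_nonneg: "f \<in> Y \<Longrightarrow> g \<in> Y \<Longrightarrow> 0 \<le> D f g"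
proof (rule field_le_epsilon)
  fix e :: real assume "f \<in> Y" "g \<in> Y" "e > 0"
  then obtain k l where "D (emb k) f < e / 2" "D g (emb l) < e / 2"
    by (metis Y_approx half_gt_zero)
  then show "0 \<le> D f g + e"
    using D_triangle[of "emb k" "emb l" f] D_triangle[of f "emb l" g] nonneg[of k l]
    by (simp add: D_emb)
qed

lemma D_rev:
  assumes "0 < r" "f \<in> Y" "g \<in> Y" "D (emb 0) f < r" "D (emb 0) g < r"
  shows "D f g \<le> \<Theta> r * D g f"
proof (rule field_le_epsilon)
  fix e :: real assume e: "e > 0"
  have \<Theta>: "1 \<le> \<Theta> r" using Theta assms by blast
  \<comment> \<open>The first entry keeps the total error below \<open>e\<close>; the other two keep
    the approximating indices strictly inside the ball of radius \<open>r\<close>, where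
    \<open>rev\<close> applies.\<close>
  define s where "s = min (e / (2 + 2 * \<Theta> r)) (min (r - D (emb 0) f) (r - D (emb 0) g))"
  have "s > 0" using e \<Theta> assms by (simp add: s_def)
  then obtain k l where k: "D f (emb k) < s" "D (emb k) f < s"
    and l: "D g (emb l) < s" "D (emb l) g < s"
    using Y_approx assms by metis
  have "\<delta> 0 k < r" "\<delta> 0 l < r"
    using D_triangle[of "emb 0" "emb k" f] D_triangle[of "emb 0" "emb l" g] k l
    by (auto simp: D_emb s_def)
  have "D f g \<le> s + \<delta> k l + s"
    using D_triangle[of f g "emb k"] D_triangle[of "emb k" g "emb l"] k l by (simp add: D_emb)
  also have "\<dots> \<le> 2 * s + \<Theta> r * \<delta> l k"
    using rev[OF assms(1) \<open>\<delta> 0 k < r\<close> \<open>\<delta> 0 l < r\<close>] by simp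
  also have "\<dots> \<le> 2 * s + \<Theta> r * (D g f + 2 * s)"
    using D_triangle[of "emb l" "emb k" g] D_triangle[of g "emb k" f] k l \<Theta>
    by (intro add_left_mono mult_left_mono) (auto simp: D_emb)
  also have "\<dots> = \<Theta> r * D g f + (2 + 2 * \<Theta> r) * s" by (simp add: algebra_simps)
  also have "\<dots> \<le> \<Theta> r * D g f + (2 + 2 * \<Theta> r) * (e / (2 + 2 * \<Theta> r))"
    using \<Theta> by (intro add_left_mono mult_left_mono) (auto simp: s_def)
  also have "\<dots> = \<Theta> r * D g f + e" using \<Theta> by simp
  finally show "D f g \<le> \<Theta> r * D g f + e" .
qed

text \<open>By itself \<open>D f g = 0\<close> gives only \<open>g \<le> f\<close> pointwise.
  Reversibility then forces \<open>D g f \<le> 0\<close>, so the supremum distance vanishes as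
  well.\<close>

lemma D_eq_0_iff: "f \<in> Y \<Longrightarrow> g \<in> Y \<Longrightarrow> D f g = 0 \<longleftrightarrow> f = g"
proof
  assume fg: "f \<in> Y" "g \<in> Y" and 0: "D f g = 0"
  define r where "r = max (D (emb 0) f) (D (emb 0) g) + 1"
  have "r > 0" using D_nonneg[OF emb_in_Y fg(1), of 0] by (simp add: r_def)
  then have "D g f \<le> 0"
    using D_rev[of r g f] fg 0 by (simp add: r_def)
  then have "dist f g \<le> 0" using dist_le_D[of f g] 0 by simp
  then show "f = g" by simp
qed (simp add: D_self)

lemma irreversible_metric_D: "irreversible_metric Y D"
  unfolding irreversible_metric_def using D_nonneg D_eq_0_iff D_triangle by blast

text \<open>The bound by \<open>R\<close> is a family of pointwise inequalities, each closed under
  uniform convergence, which gives completeness; total boundedness comes from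
  \<open>nets\<close>.\<close>

lemma compact_D_ball: "compact {f \<in> Y. D (emb 0) f \<le> R}"
  unfolding compact_eq_totally_bounded
proof (intro conjI allI impI)
  have "closed {f. D (emb 0) f \<le> R}"
  proof -
    have "{f. D (emb 0) f \<le> R} = (\<Inter>m. {f. apply_bcontfun f m \<le> R + apply_bcontfun (emb 0) m})"
    proof (intro equalityI subsetI INT_I CollectI; clarsimp)
      fix f m assume "D (emb 0) f \<le> R"
      then show "apply_bcontfun f m \<le> R + apply_bcontfun (emb 0) m"
        using apply_diff_le_D[of f m "emb 0"] by linarith
    next
      fix f assume "\<forall>m. apply_bcontfun f m \<le> R + apply_bcontfun (emb 0) m"
      then show "D (emb 0) f \<le> R" by (intro D_leI) (simp add: algebra_simps)
    qed
    also have "closed \<dots>"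
    proof (intro closed_INT ballI closed_Collect_le continuous_on_const)
      fix m
      have "1-lipschitz_on UNIV (\<lambda>f::nat \<Rightarrow>\<^sub>C real. apply_bcontfun f m)"
        by (intro lipschitz_onI) (auto simp: dist_bounded)
      then show "continuous_on UNIV (\<lambda>f::nat \<Rightarrow>\<^sub>C real. apply_bcontfun f m)"
        by (rule lipschitz_on_continuous_on)
    qed
    finally show ?thesis .
  qed
  then have "closed (Y \<inter> {f. D (emb 0) f \<le> R})" by (simp add: Y_def closed_Int)
  then show "complete {f \<in> Y. D (emb 0) f \<le> R}"
    using complete_closed_subset[OF _ subset_UNIV complete_UNIV_bcontfun]
    by (simp add: Int_def)
next
  fix e :: real assume e: "e > 0"
  \<comment> \<open>The margin 1 makes room for an index approximating \<open>f\<close> to within 1;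
    the maximum makes the radius positive.\<close>
  define r where "r = max R 0 + 1"
  then have "0 < r" by simp
  obtain M where M: "\<And>k. \<delta> 0 k < r \<Longrightarrow> \<exists>l<M. \<delta> k l < e / 2 \<and> \<delta> l k < e / 2"
    using nets[OF \<open>0 < r\<close> half_gt_zero[OF e]] by blast
  have "{f \<in> Y. D (emb 0) f \<le> R} \<subseteq> (\<Union>g\<in>emb ` {..<M}. ball g e)"
  proof clarsimp
    fix f assume f: "f \<in> Y" "D (emb 0) f \<le> R"
    obtain k where k: "D f (emb k) < min (e / 2) 1" "D (emb k) f < min (e / 2) 1"
      using Y_approx[OF f(1), of "min (e / 2) 1"] e by auto
    then have "\<delta> 0 k < r" using D_triangle[of "emb 0" "emb k" f] f by (auto simp: D_emb r_def)
    then obtain l where l: "l < M" "\<delta> k l < e / 2" "\<delta> l k < e / 2" using M by blast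
    have "dist (emb l) f < e"
      using dist_le_D[of "emb l" f] D_triangle[of f "emb l" "emb k"]
        D_triangle[of "emb l" f "emb k"] k l by (auto simp: D_emb)
    with l show "\<exists>x\<in>{..<M}. dist (emb x) f < e" by blast
  qed
  then show "\<exists>k. finite k \<and> {f \<in> Y. D (emb 0) f \<le> R} \<subseteq> (\<Union>x\<in>k. ball x e)"
    by (intro exI[of _ "emb ` {..<M}"]) auto
qed

text \<open>The injection \<open>h\<close> carries \<open>Y\<close> to a set of reals and
  \<open>inv h\<close> pulls the distance back. The points \<open>p k\<close> are the images of
  \<open>emb k\<close>, possibly with repetitions.\<close>

lemma completion_exists:
  obtains L :: "real pointed_space" and p :: "nat \<Rightarrow> real"
  where "L \<in> forward_spaces \<Theta>" "\<And>k. p k \<in> points L" "base L = p 0"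
    "\<And>k l. dst L (p k) (p l) = \<delta> k l"
    "\<And>z e. z \<in> points L \<Longrightarrow> 0 < e \<Longrightarrow> \<exists>k. dst L (p k) z < e \<and> dst L z (p k) < e"
proof -
  obtain h :: "(nat \<Rightarrow>\<^sub>C real) \<Rightarrow> real" where h: "inj h"
    using inj_bcontfun_real_exists by blast
  define L where "L = \<lparr>points = h ` Y, base = h (emb 0), dst = (\<lambda>a b. D (inv h a) (inv h b))\<rparr>"
  have L_simps: "points L = h ` Y" "base L = h (emb 0)"
    and dst_L: "dst L (h f) (h g) = D f g" for f g
    using h by (simp_all add: L_def)
  interpret L: locally_reversible "points L" "dst L" "base L" \<Theta>
  proof
    show "irreversible_metric (points L) (dst L)"
      using irreversible_metric_D h
      unfolding irreversible_metric_def by (simp add: L_simps dst_L inj_eq)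
    show "base L \<in> points L" using emb_in_Y by (simp add: L_simps)
    fix r x y
    assume "0 < r" "x \<in> points L" "y \<in> points L" "dst L (base L) x < r" "dst L (base L) y < r"
    then show "dst L x y \<le> \<Theta> r * dst L y x"
      using D_rev by (auto simp: L_simps dst_L)
  qed (rule Theta)
  have "forward_boundedly_compact (points L) (dst L)"
  proof (rule L.forward_boundedly_compactI)
    fix R and \<sigma> :: "nat \<Rightarrow> real"
    assume \<sigma>: "\<And>n. \<sigma> n \<in> points L \<and> dst L (base L) (\<sigma> n) \<le> R"
    define \<tau> where "\<tau> = inv h \<circ> \<sigma>"
    have h\<tau>: "\<sigma> n = h (\<tau> n)" and \<tau>: "\<tau> n \<in> {f \<in> Y. D (emb 0) f \<le> R}" for n
      using \<sigma>[of n] h by (auto simp: \<tau>_def L_simps dst_L)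
    obtain f k where f: "f \<in> {f \<in> Y. D (emb 0) f \<le> R}" and k: "strict_mono (k::nat \<Rightarrow> nat)"
      and lim: "(\<tau> \<circ> k) \<longlonglongrightarrow> f"
      using compact_D_ball[of R] \<tau> unfolding compact_def by blast
    \<comment> \<open>Each one-sided distance is at most the supremum distance, so twice the latter
      dominates \<open>sym_dist\<close>.\<close>
    have lim0: "(\<lambda>n. 2 * dist (\<tau> (k n)) f) \<longlonglongrightarrow> 0"
      using lim tendsto_mult_right_zero tendsto_dist_iff by (fastforce simp: o_def)
    have "(\<lambda>n. L.sym_dist (\<sigma> (k n)) (h f)) \<longlonglongrightarrow> 0"
    proof (rule tendsto_sandwich[OF _ _ tendsto_const lim0])
      have "L.sym_dist (\<sigma> (k n)) (h f) \<le> 2 * dist (\<tau> (k n)) f" for n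
        using D_le_dist[of "\<tau> (k n)" f] D_le_dist[of f "\<tau> (k n)"] D_nonneg[of "\<tau> (k n)" f]
          D_nonneg[of f "\<tau> (k n)"] \<tau>[of "k n"] f
        by (simp add: L.sym_dist_def h\<tau> dst_L dist_commute)
      then show "\<forall>\<^sub>F n in sequentially. L.sym_dist (\<sigma> (k n)) (h f) \<le> 2 * dist (\<tau> (k n)) f"
        by simp
    qed simp
    then show "\<exists>x\<in>points L. \<exists>k. strict_mono (k::nat \<Rightarrow> nat) \<and> (\<lambda>n. L.sym_dist (\<sigma> (k n)) x) \<longlonglongrightarrow> 0"
      using f k by (auto simp: L_simps)
  qed
  then have "L \<in> forward_spaces \<Theta>"
    using L.irrev L.base_in L.reversibility_base_ball
    by (simp add: forward_spaces_def pointed_forward_metric_space_def)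
  moreover have "\<exists>k. dst L (h (emb k)) z < e \<and> dst L z (h (emb k)) < e"
    if "z \<in> points L" "0 < e" for z e
    using that Y_approx by (metis L_simps(1) dst_L imageE)
  ultimately show thesis
    using emb_in_Y by (intro that[of L "h \<circ> emb"]) (auto simp: L_simps dst_L D_emb)
qed

end

section \<open>Nets and convergence\<close>

lemma covering_number_enumerate:
  assumes "covering_number Y d \<epsilon> \<le> enat N" "b \<in> Y"
  obtains e :: "nat \<Rightarrow> 'a" where "\<And>j. e j \<in> Y" "\<And>z. z \<in> Y \<Longrightarrow> \<exists>j<N. d (e j) z < \<epsilon>"
proof -
  \<comment> \<open>A strict bound turns the infimum into an actual cover by at most
    \<open>N\<close> balls.\<close>
  have "covering_number Y d \<epsilon> < enat (Suc N)"
    using assms(1) by (rule le_less_trans) simp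
  then obtain F where F: "finite F" "F \<subseteq> Y" "Y \<subseteq> (\<Union>x\<in>F. forward_ball Y d x \<epsilon>)" "card F < Suc N"
    by (auto simp: covering_number_def INF_less_iff)
  obtain h where h: "bij_betw h {0..<card F} F" using ex_bij_betw_nat_finite[OF F(1)] by blast
  show thesis
  proof
    \<comment> \<open>The cover may have fewer than \<open>N\<close> centres; the default
      \<open>b\<close> fills the remaining indices.\<close>
    show "(if j < card F then h j else b) \<in> Y" for j
      using h F assms(2) by (auto simp: bij_betw_def)
    fix z assume "z \<in> Y"
    then obtain x where "x \<in> F" "d x z < \<epsilon>" using F by (auto simp: forward_ball_def)
    moreover then obtain j where "j < card F" "x = h j"
      using h by (fastforce simp: bij_betw_def)
    ultimately show "\<exists>j<N. d (if j < card F then h j else b) z < \<epsilon>"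
      using F by (intro exI[of _ j]) auto
  qed
qed

text \<open>A positive index encodes a radius \<open>n + 1\<close>, a scale
  \<open>1 / (m + 1)\<close> and a position in the corresponding net. Since the covering bounds are
  uniform, the same finite set of indices serves in every space. The clause on the base point later
  makes the approximating maps pointed.\<close>

lemma uniform_nets_exist:
  fixes S :: "nat \<Rightarrow> 'a pointed_space"
  assumes \<Theta>: "\<And>r. 0 < r \<Longrightarrow> 1 \<le> \<Theta> r"
    and S: "\<And>i. S i \<in> forward_spaces \<Theta>"
    and cov: "\<And>r \<epsilon>. 0 < r \<Longrightarrow> 0 < \<epsilon> \<Longrightarrow>
           \<exists>N::nat. \<forall>i. covering_number (base_ball (S i) r) (dst (S i)) \<epsilon> \<le> enat N"
  obtains y :: "nat \<Rightarrow> nat \<Rightarrow> 'a" and R :: "nat \<Rightarrow> real"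
  where "\<And>i. y i 0 = base (S i)" "\<And>i k. y i k \<in> points (S i)"
    "\<And>i k. dst (S i) (base (S i)) (y i k) < R k"
    "\<And>r e. 0 < r \<Longrightarrow> 0 < e \<Longrightarrow> \<exists>M. \<forall>i. \<forall>z\<in>base_ball (S i) r.
       \<exists>k<M. dst (S i) (y i k) z < e \<and> dst (S i) z (y i k) < e \<and> (z = base (S i) \<longrightarrow> k = 0)"
proof -
  have rev: "locally_reversible (points (S i)) (dst (S i)) (base (S i)) \<Theta>" for i
    by (rule forward_spaces_locally_reversible[OF S \<Theta>])
  note irrev = locally_reversible.irrev[OF rev]
  note base_in = locally_reversible.base_in[OF rev]
  have base_0: "dst (S i) (base (S i)) (base (S i)) = 0" for i
    by (rule locally_reversible.dist_self[OF rev base_in])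
  have base_ball: "base (S i) \<in> base_ball (S i) r" if "0 < r" for i r
    using base_0 base_in irrev that by (intro closed_forward_ball_superset) auto
  have "\<exists>N. \<forall>n m i. covering_number (base_ball (S i) (Suc n)) (dst (S i)) (1 / Suc m) \<le> enat (N n m)"
    using cov[of "real (Suc _)" "1 / Suc _"] by (intro choice allI) simp
  then obtain N where N: "\<And>n m i.
      covering_number (base_ball (S i) (Suc n)) (dst (S i)) (1 / Suc m) \<le> enat (N n m)"
    by blast
  have "\<exists>e. (\<forall>j. e j \<in> base_ball (S i) (Suc n)) \<and>
      (\<forall>z\<in>base_ball (S i) (Suc n). \<exists>j<N n m. dst (S i) (e j) z < 1 / Suc m)" for i n m
    by (rule covering_number_enumerate[OF N base_ball]) auto
  then obtain E where E: "\<And>i n m j. E i n m j \<in> base_ball (S i) (Suc n)"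
    "\<And>i n m z. z \<in> base_ball (S i) (Suc n) \<Longrightarrow> \<exists>j<N n m. dst (S i) (E i n m j) z < 1 / Suc m"
    by metis
  define y where "y i k = (case k of 0 \<Rightarrow> base (S i)
    | Suc c \<Rightarrow> (case prod_decode c of (n, c') \<Rightarrow> case prod_decode c' of (m, j) \<Rightarrow> E i n m j))" for i k
  \<comment> \<open>A net point of the closed ball of radius \<open>n + 1\<close> is at distance at
    most \<open>n + 1\<close> from the base point, hence less than \<open>n + 2\<close>.\<close>
  define R where "R k = (case k of 0 \<Rightarrow> 1 | Suc c \<Rightarrow> real (fst (prod_decode c)) + 2)" for k
  have E_in: "E i n m j \<in> points (S i)" for i n m j
    using E(1) locally_reversible.closed_ball_subset[OF rev] by blast
  have E_le: "dst (S i) (base (S i)) (E i n m j) \<le> Suc n" for i n m j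
    by (rule locally_reversible.closed_ball_le[OF rev base_in E(1)])
  show thesis
  proof
    show "y i 0 = base (S i)" for i by (simp add: y_def)
    show "y i k \<in> points (S i)" for i k
      using base_in E_in by (auto simp: y_def split: nat.split prod.split)
    show "dst (S i) (base (S i)) (y i k) < R k" for i k
    proof (cases k)
      case (Suc c)
      obtain n m j where "c = prod_encode (n, prod_encode (m, j))"
        by (metis prod_decode_inverse surj_pair)
      with Suc show ?thesis using E_le[of i n m j] by (simp add: y_def R_def)
    qed (simp add: y_def R_def base_0)
    fix r e :: real assume r: "0 < r" and e: "0 < e"
    obtain n where n: "r \<le> Suc n" using real_arch_simple[of r] order_trans[OF _ of_nat_mono[OF le_SucI[OF order_refl]]] by blast
    \<comment> \<open>Both \<open>z\<close> and its net point lie strictly inside the ball of radius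
      \<open>n + 2\<close>, so a forward distance below \<open>e / \<theta>\<close> yields a
      backward distance below \<open>e\<close>.\<close>
    define \<theta> where "\<theta> = \<Theta> (real n + 2)"
    have \<theta>: "1 \<le> \<theta>" using \<Theta> by (simp add: \<theta>_def)
    obtain m where m: "1 / Suc m < e / \<theta>"
      using nat_approx_posE[of "e / \<theta>"] e \<theta> by auto
    have "e / \<theta> \<le> e / 1" using e \<theta> by (intro divide_left_mono) auto
    define K where "K = insert 0 ((\<lambda>j. Suc (prod_encode (n, prod_encode (m, j)))) ` {..<N n m})"
    have "finite K" by (simp add: K_def)
    then obtain M where M: "\<And>k. k \<in> K \<Longrightarrow> k < M"
      by (auto simp: finite_nat_set_iff_bounded)
    have "\<exists>k<M. dst (S i) (y i k) z < e \<and> dst (S i) z (y i k) < e \<and> (z = base (S i) \<longrightarrow> k = 0)"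
      if z: "z \<in> base_ball (S i) r" for i z
    proof (cases "z = base (S i)")
      case True
      then show ?thesis
        using M[of 0] e base_0 by (intro exI[of _ 0]) (simp add: K_def y_def)
    next
      case False
      interpret S: locally_reversible "points (S i)" "dst (S i)" "base (S i)" \<Theta> by (rule rev)
      have z_in: "z \<in> points (S i)" using z S.closed_ball_subset by blast
      have "dst (S i) (base (S i)) z \<le> r" by (rule S.closed_ball_le[OF base_in z])
      have "z \<in> base_ball (S i) (Suc n)"
        using z n unfolding mem_closed_forward_ball_iff[OF irrev] by (meson less_le_trans)
      then obtain j where j: "j < N n m" "dst (S i) (E i n m j) z < 1 / Suc m"
        using E(2) by blast
      let ?k = "Suc (prod_encode (n, prod_encode (m, j)))"
      have yk: "y i ?k = E i n m j" by (simp add: y_def)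
      have "dst (S i) z (E i n m j) \<le> \<theta> * dst (S i) (E i n m j) z"
        unfolding \<theta>_def using E_in E_le[of i n m j] z_in n \<open>dst (S i) (base (S i)) z \<le> r\<close>
        by (intro S.rev) auto
      also have "\<dots> < \<theta> * (e / \<theta>)"
        using \<theta> j m by (intro mult_strict_left_mono) auto
      finally have "dst (S i) z (E i n m j) < e" using \<theta> by simp
      moreover have "dst (S i) (E i n m j) z < e"
        using j m \<open>e / \<theta> \<le> e / 1\<close> by simp
      moreover have "?k < M" using j by (intro M) (auto simp: K_def)
      ultimately show ?thesis using False by (intro exI[of _ ?k]) (simp add: yk)
    qed
    then show "\<exists>M. \<forall>i. \<forall>z\<in>base_ball (S i) r. \<exists>k<M. dst (S i) (y i k) z < e \<and>
        dst (S i) z (y i k) < e \<and> (z = base (S i) \<longrightarrow> k = 0)"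
      by blast
  qed
qed

text \<open>Division by \<open>B x + 1\<close>, positive even where \<open>B x = 0\<close>,
  normalizes all bounds to 1. The diagonal argument on a countable set then applies, and the scaling
  is undone pointwise.\<close>

lemma pointwise_bounded_convergent_subsequence:
  fixes f :: "nat \<Rightarrow> 'k::countable \<Rightarrow> real"
  assumes "\<And>n x. \<bar>f n x\<bar> \<le> B x"
  shows "\<exists>\<phi> g. strict_mono (\<phi> :: nat \<Rightarrow> nat) \<and> (\<forall>x. (\<lambda>n. f (\<phi> n) x) \<longlonglongrightarrow> g x)"
proof -
  define h where "h n x = f n x / (B x + 1)" for n x
  have pos: "0 < B x + 1" for x using assms[of 0 x] by linarith
  have h: "norm (h n x) \<le> 1" for n x
    using assms[of n x] pos[of x] by (simp add: h_def)
  have "\<exists>\<phi>. strict_mono (\<phi> :: nat \<Rightarrow> nat) \<and> (\<forall>x. \<exists>l. (\<lambda>n. h (\<phi> n) x) \<longlonglongrightarrow> l)"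
    by (rule function_convergent_subsequence[of UNIV h 1, OF countableI_type h]) blast
  then obtain \<phi> where \<phi>: "strict_mono (\<phi> :: nat \<Rightarrow> nat)" "\<And>x. \<exists>l. (\<lambda>n. h (\<phi> n) x) \<longlonglongrightarrow> l"
    by blast
  have "\<exists>l. (\<lambda>n. f (\<phi> n) x) \<longlonglongrightarrow> l" for x
  proof -
    obtain l where "(\<lambda>n. h (\<phi> n) x) \<longlonglongrightarrow> l" using \<phi>(2)[of x] by blast
    then have "(\<lambda>n. h (\<phi> n) x * (B x + 1)) \<longlonglongrightarrow> l * (B x + 1)"
      by (intro tendsto_intros)
    then show ?thesis using pos[of x] by (auto simp: h_def)
  qed
  then show ?thesis using \<phi>(1) by metis
qed

text \<open>Non-strict inequalities pass to the limit, and strict premises such as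
  \<open>\<delta> 0 k < r\<close> hold eventually along the sequence.\<close>

lemma limit_quasi_pseudo_metric_nets:
  fixes S :: "nat \<Rightarrow> 'a pointed_space"
  assumes \<Theta>: "\<And>r. 0 < r \<Longrightarrow> 1 \<le> \<Theta> r"
    and S: "\<And>i. S i \<in> forward_spaces \<Theta>"
    and y: "\<And>i. y i 0 = base (S i)" "\<And>i k. y i k \<in> points (S i)"
    and nets: "\<And>r e. 0 < r \<Longrightarrow> 0 < e \<Longrightarrow> \<exists>M. \<forall>i. \<forall>z\<in>base_ball (S i) r.
       \<exists>k<M. dst (S i) (y i k) z < e \<and> dst (S i) z (y i k) < e"
    and lim: "\<And>k l. (\<lambda>i. dst (S i) (y i k) (y i l)) \<longlonglongrightarrow> \<delta> k l"
  shows "quasi_pseudo_metric_nets \<delta> \<Theta>"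
proof
  have rev: "locally_reversible (points (S i)) (dst (S i)) (base (S i)) \<Theta>" for i
    by (rule forward_spaces_locally_reversible[OF S \<Theta>])
  note below = order_tendstoD(2)[OF lim]
  show "0 \<le> \<delta> k l" for k l
    using lim by (rule LIMSEQ_le_const) (use locally_reversible.nonneg[OF rev] y in blast)
  show "\<delta> k k = 0" for k
    using lim[of k k] by (simp add: locally_reversible.dist_self[OF rev y(2)] LIMSEQ_const_iff)
  show "\<delta> k m \<le> \<delta> k l + \<delta> l m" for k l m
    using lim tendsto_add[OF lim lim]
    by (rule LIMSEQ_le) (use locally_reversible.triangle[OF rev] y in blast)
  show "1 \<le> \<Theta> r" if "0 < r" for r using \<Theta> that .
  show "\<delta> k l \<le> \<Theta> r * \<delta> l k" if "0 < r" "\<delta> 0 k < r" "\<delta> 0 l < r" for r k l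
  proof (rule tendsto_le[OF sequentially_bot tendsto_mult_left[OF lim] lim])
    show "\<forall>\<^sub>F i in sequentially.
        dst (S i) (y i k) (y i l) \<le> \<Theta> r * dst (S i) (y i l) (y i k)"
      using below[OF that(2)] below[OF that(3)]
      by eventually_elim (rule locally_reversible.rev[OF rev], use that y in auto)
  qed
  fix r e :: real assume "0 < r" "0 < e"
  then obtain M where M: "\<And>i z. z \<in> base_ball (S i) r \<Longrightarrow>
      \<exists>k<M. dst (S i) (y i k) z < e / 2 \<and> dst (S i) z (y i k) < e / 2"
    using nets[of r "e / 2"] by auto
  have "\<exists>l<M. \<delta> k l < e \<and> \<delta> l k < e" if k: "\<delta> 0 k < r" for k
  \<comment> \<open>If every \<open>l < M\<close> were far from \<open>k\<close> in the limit, then,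
    \<open>M\<close> being finite, some single \<open>S i\<close> would have all
    \<open>y i l\<close> far from \<open>y i k\<close>, against its net. Net size
    \<open>e / 2\<close> against \<open>e\<close> leaves the strict gap that this needs.\<close>
  proof (rule ccontr)
    assume "\<not> ?thesis"
    then have far: "e / 2 < \<delta> k l \<or> e / 2 < \<delta> l k" if "l < M" for l
      using that \<open>0 < e\<close> by (smt (verit) field_sum_of_halves)
    have "\<forall>\<^sub>F i in sequentially. e / 2 < dst (S i) (y i k) (y i l) \<or> e / 2 < dst (S i) (y i l) (y i k)"
      if "l < M" for l
      using far[OF that]
    proof
      assume "e / 2 < \<delta> k l"
      from order_tendstoD(1)[OF lim this] show ?thesis by eventually_elim simp
    next
      assume "e / 2 < \<delta> l k"
      from order_tendstoD(1)[OF lim this] show ?thesis by eventually_elim simp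
    qed
    then have "\<forall>\<^sub>F i in sequentially. \<forall>l\<in>{..<M}.
        e / 2 < dst (S i) (y i k) (y i l) \<or> e / 2 < dst (S i) (y i l) (y i k)"
      by (intro eventually_ball_finite) auto
    with below[OF k] have "\<forall>\<^sub>F i in sequentially. dst (S i) (y i 0) (y i k) < r \<and> (\<forall>l\<in>{..<M}.
        e / 2 < dst (S i) (y i k) (y i l) \<or> e / 2 < dst (S i) (y i l) (y i k))"
      by (rule eventually_conj)
    from eventually_happens'[OF sequentially_bot this]
    obtain i where i: "dst (S i) (y i 0) (y i k) < r"
      "\<And>l. l < M \<Longrightarrow> e / 2 < dst (S i) (y i k) (y i l) \<or> e / 2 < dst (S i) (y i l) (y i k)"
      by blast
    have "y i k \<in> base_ball (S i) r"
      using i y by (intro closed_forward_ball_superset locally_reversible.irrev[OF rev]) auto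
    then obtain l where "l < M" "dst (S i) (y i l) (y i k) < e / 2" "dst (S i) (y i k) (y i l) < e / 2"
      using M by blast
    then show False using i(2)[of l] by auto
  qed
  then show "\<exists>M. \<forall>k. \<delta> 0 k < r \<longrightarrow> (\<exists>l<M. \<delta> k l < e \<and> \<delta> l k < e)" by blast
qed

text \<open>The approximating map sends \<open>z\<close> to \<open>p k\<close>, where
  \<open>y i k\<close> is a net point near \<open>z\<close>. Only indices below a fixed
  \<open>M\<close> occur, so finitely many distances have to be close.\<close>

lemma forward_GH_converges_of_nets:
  fixes S :: "nat \<Rightarrow> 'a pointed_space" and L :: "'b pointed_space"
    and y :: "nat \<Rightarrow> nat \<Rightarrow> 'a" and p :: "nat \<Rightarrow> 'b"
  assumes \<Theta>: "\<And>r. 0 < r \<Longrightarrow> 1 \<le> \<Theta> r"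
    and S: "\<And>i. S i \<in> forward_spaces \<Theta>" and L: "L \<in> forward_spaces \<Theta>"
    and y: "\<And>i. y i 0 = base (S i)" "\<And>i k. y i k \<in> points (S i)"
    and p: "base L = p 0" "\<And>k. p k \<in> points L"
    and nets: "\<And>r e. 0 < r \<Longrightarrow> 0 < e \<Longrightarrow> \<exists>M. \<forall>i. \<forall>z\<in>base_ball (S i) r.
       \<exists>k<M. dst (S i) (y i k) z < e \<and> dst (S i) z (y i k) < e \<and> (z = base (S i) \<longrightarrow> k = 0)"
    and nets_L: "\<And>r e. 0 < r \<Longrightarrow> 0 < e \<Longrightarrow> \<exists>M. \<forall>k. dst L (p 0) (p k) < r \<longrightarrow>
       (\<exists>l<M. dst L (p k) (p l) < e \<and> dst L (p l) (p k) < e)"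
    and dense: "\<And>z e. z \<in> points L \<Longrightarrow> 0 < e \<Longrightarrow> \<exists>k. dst L (p k) z < e \<and> dst L z (p k) < e"
    and lim: "\<And>k l. (\<lambda>i. dst (S i) (y i k) (y i l)) \<longlonglongrightarrow> dst L (p k) (p l)"
  shows "forward_GH_converges \<Theta> S L"
  unfolding forward_GH_converges_def
proof (intro conjI allI impI S L)
  have rev: "locally_reversible (points (S i)) (dst (S i)) (base (S i)) \<Theta>" for i
    by (rule forward_spaces_locally_reversible[OF S \<Theta>])
  interpret L: locally_reversible "points L" "dst L" "base L" \<Theta>
    by (rule forward_spaces_locally_reversible[OF L \<Theta>])
  fix r \<epsilon> :: real assume r: "0 < r" and \<epsilon>: "0 < \<epsilon>"
  \<comment> \<open>The distortion estimate spends three errors of size \<open>s\<close>, the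
    covering estimate four.\<close>
  define s where "s = \<epsilon> / 4"
  have s: "0 < s" using \<epsilon> by (simp add: s_def)
  obtain M1 where M1: "\<And>i z. z \<in> base_ball (S i) r \<Longrightarrow>
      \<exists>k<M1. dst (S i) (y i k) z < s \<and> dst (S i) z (y i k) < s \<and> (z = base (S i) \<longrightarrow> k = 0)"
    using nets[OF r s] by metis
  obtain M2 where M2: "\<And>k. dst L (p 0) (p k) < r \<Longrightarrow>
      \<exists>l<M2. dst L (p k) (p l) < s \<and> dst L (p l) (p k) < s"
    using nets_L[OF r s] by metis
  define M where "M = max M1 M2"
  have M_ge: "M1 \<le> M" "M2 \<le> M" by (simp_all add: M_def)
  have "\<forall>\<^sub>F i in sequentially. \<forall>(k, l)\<in>{..<M} \<times> {..<M}.
      \<bar>dst (S i) (y i k) (y i l) - dst L (p k) (p l)\<bar> < s"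
  proof (intro eventually_ball_finite ballI)
    fix kl assume "kl \<in> {..<M} \<times> {..<M}"
    show "\<forall>\<^sub>F i in sequentially. case kl of (k, l) \<Rightarrow>
        \<bar>dst (S i) (y i k) (y i l) - dst L (p k) (p l)\<bar> < s"
      using tendstoD[OF lim s, of "fst kl" "snd kl"] by (simp add: dist_real_def case_prod_unfold)
  next
    show "finite ({..<M} \<times> {..<M})" by (intro finite_cartesian_product finite_lessThan)
  qed
  then obtain N where N0: "\<And>i. N \<le> i \<Longrightarrow> \<forall>(k, l)\<in>{..<M} \<times> {..<M}.
      \<bar>dst (S i) (y i k) (y i l) - dst L (p k) (p l)\<bar> < s"
    unfolding eventually_sequentially by blast
  have N: "\<bar>dst (S i) (y i k) (y i l) - dst L (p k) (p l)\<bar> < s"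
    if "N \<le> i" "k < M" "l < M" for i k l
    using bspec[OF N0[OF that(1)], of "(k, l)"] that by simp
  show "\<exists>N. \<forall>i>N. \<exists>f\<in>base_ball (S i) r \<rightarrow> points L.
      f (base (S i)) = base L \<and> distortion (base_ball (S i) r) (dst (S i)) (dst L) f \<le> ereal \<epsilon> \<and>
      base_ball L (r - \<epsilon>) \<subseteq>
        forward_neighbourhood (points L) (dst L) (f ` base_ball (S i) r) \<epsilon>"
  proof (intro exI[of _ N] allI impI)
    fix i assume "N < i"
    then have i: "\<bar>dst (S i) (y i k) (y i l) - dst L (p k) (p l)\<bar> < s" if "k < M" "l < M" for k l
      using N that by simp
    interpret S: locally_reversible "points (S i)" "dst (S i)" "base (S i)" \<Theta> by (rule rev)
    let ?B = "base_ball (S i) r"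
    note in_S = subsetD[OF S.closed_ball_subset]
    \<comment> \<open>The last clause sends the base point to \<open>p 0\<close>, the base point of
      \<open>L\<close>.\<close>
    obtain \<kappa> where \<kappa>: "\<And>z. z \<in> ?B \<Longrightarrow> \<kappa> z < M1 \<and> dst (S i) (y i (\<kappa> z)) z < s \<and>
        dst (S i) z (y i (\<kappa> z)) < s \<and> (z = base (S i) \<longrightarrow> \<kappa> z = 0)"
      using M1[of _ i] by metis
    have \<kappa>_M: "\<kappa> z < M" if "z \<in> ?B" for z using \<kappa>[OF that] M_ge by linarith
    have base_B: "base (S i) \<in> ?B"
      by (rule closed_forward_ball_superset[OF S.irrev S.base_in]) (simp add: r S.dist_self[OF S.base_in])
    have "\<bar>dst L (p (\<kappa> x)) (p (\<kappa> x')) - dst (S i) x x'\<bar> \<le> \<epsilon>"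
      if x: "x \<in> ?B" "x' \<in> ?B" for x x'
    proof -
      let ?y = "y i (\<kappa> x)" and ?y' = "y i (\<kappa> x')"
      note in_S = in_S[OF x(1)] in_S[OF x(2)]
      have "dst (S i) x x' \<le> dst (S i) x ?y + dst (S i) ?y ?y' + dst (S i) ?y' x'"
        using S.triangle[OF in_S(1) y(2) in_S(2), of "\<kappa> x"]
          S.triangle[OF y(2) y(2) in_S(2), of "\<kappa> x" "\<kappa> x'"] by linarith
      moreover have "dst (S i) ?y ?y' \<le> dst (S i) ?y x + dst (S i) x x' + dst (S i) x' ?y'"
        using S.triangle[OF y(2) in_S(1) y(2), of "\<kappa> x" "\<kappa> x'"]
          S.triangle[OF in_S y(2), of "\<kappa> x'"] by linarith
      ultimately show ?thesis
        using i[OF \<kappa>_M[OF x(1)] \<kappa>_M[OF x(2)]] \<kappa>[OF x(1)] \<kappa>[OF x(2)]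
        unfolding s_def by linarith
    qed
    then have dis: "distortion ?B (dst (S i)) (dst L) (p \<circ> \<kappa>) \<le> ereal \<epsilon>"
      unfolding distortion_def by (intro SUP_least) auto
    have cover: "w \<in> forward_neighbourhood (points L) (dst L) ((p \<circ> \<kappa>) ` ?B) \<epsilon>"
      if w: "w \<in> base_ball L (r - \<epsilon>)" for w
    proof -
      have w_in: "w \<in> points L" using w L.closed_ball_subset by blast
      have w_le: "dst L (p 0) w \<le> r - \<epsilon>" using L.closed_ball_le[OF L.base_in w] by (simp add: p)
      obtain k where k: "dst L (p k) w < s" "dst L w (p k) < s" using dense[OF w_in s] by blast
      \<comment> \<open>From \<open>w\<close>, at distance at most \<open>r - 4 * s\<close>, the
        passages to \<open>p k\<close>, to \<open>p l\<close> and to \<open>y i l\<close> cost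
        \<open>s\<close> each. The radius stays below \<open>r\<close>, so \<open>y i l\<close> lies
        in the domain of the map.\<close>
      have k_less: "dst L (p 0) (p k) < r - 3 * s"
        using L.triangle[OF p(2) w_in p(2), of 0 k] w_le k by (simp add: s_def)
      then obtain l where l: "l < M2" "dst L (p k) (p l) < s" "dst L (p l) (p k) < s"
        using M2[of k] s by auto
      have "dst (S i) (y i 0) (y i l) < r"
        using L.triangle[OF p(2) p(2) p(2), of 0 l k] k_less l i[of 0 l] s M_ge by linarith
      then have yl: "y i l \<in> ?B"
        by (intro closed_forward_ball_superset[OF S.irrev]) (simp_all add: y flip: y(1))
      \<comment> \<open>The map sends \<open>y i l\<close> to \<open>p ?k\<close>, which may differ
        from \<open>p l\<close>: one \<open>s\<close> accounts for the net in \<open>S i\<close> and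
        another for the transfer to \<open>L\<close>.\<close>
      let ?k = "\<kappa> (y i l)"
      have "dst L (p ?k) (p l) < 2 * s"
        using i[OF \<kappa>_M[OF yl], of l] \<kappa>[OF yl] l M_ge by linarith
      then have "dst L (p ?k) w < \<epsilon>"
        using L.triangle[OF p(2) p(2) w_in, of ?k l] L.triangle[OF p(2) p(2) w_in, of l k] l k
        unfolding s_def by linarith
      then show ?thesis
        using w_in yl by (auto simp: forward_neighbourhood_def INF_less_iff)
    qed
    show "\<exists>f\<in>?B \<rightarrow> points L.
      f (base (S i)) = base L \<and> distortion ?B (dst (S i)) (dst L) f \<le> ereal \<epsilon> \<and>
      base_ball L (r - \<epsilon>) \<subseteq> forward_neighbourhood (points L) (dst L) (f ` ?B) \<epsilon>"
      using dis cover p \<kappa>[OF base_B] by (intro bexI[of _ "p \<circ> \<kappa>"]) auto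
  qed
qed

theorem theorem3p27:
  fixes \<Theta> :: "real \<Rightarrow> real" and \<C> :: "'a pointed_space set"
  assumes "\<And>r. 0 < r \<Longrightarrow> 1 \<le> \<Theta> r"
    and "mono_on {0<..} \<Theta>"
    and "\<C> \<subseteq> forward_spaces \<Theta>"
    and "\<And>r \<epsilon>. 0 < r \<Longrightarrow> 0 < \<epsilon> \<Longrightarrow>
           \<exists>N::nat. \<forall>S\<in>\<C>. covering_number (base_ball S r) (dst S) \<epsilon> \<le> enat N"
  shows "forward_GH_precompact \<Theta> \<C>"
  unfolding forward_GH_precompact_def
proof (intro allI impI)
  fix S :: "nat \<Rightarrow> 'a pointed_space" assume S_in: "\<forall>i. S i \<in> \<C>"
  then have S: "S i \<in> forward_spaces \<Theta>" for i using assms(3) by blast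
  have cov: "\<exists>N::nat. \<forall>i. covering_number (base_ball (S i) r) (dst (S i)) \<epsilon> \<le> enat N"
    if "0 < r" "0 < \<epsilon>" for r \<epsilon>
    using assms(4)[OF that] S_in by blast
  show "\<exists>\<phi> (L :: real pointed_space). strict_mono \<phi> \<and> L \<in> forward_spaces \<Theta> \<and>
      forward_GH_converges \<Theta> (S \<circ> \<phi>) L"
  proof (rule uniform_nets_exist[of \<Theta> S])
    show "1 \<le> \<Theta> r" if "0 < r" for r using assms(1) that .
  next
    fix y :: "nat \<Rightarrow> nat \<Rightarrow> 'a" and R :: "nat \<Rightarrow> real"
    assume y: "\<And>i. y i 0 = base (S i)" "\<And>i k. y i k \<in> points (S i)"
      and R: "\<And>i k. dst (S i) (base (S i)) (y i k) < R k"
      and nets: "\<And>r e. 0 < r \<Longrightarrow> 0 < e \<Longrightarrow> \<exists>M. \<forall>i. \<forall>z\<in>base_ball (S i) r.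
         \<exists>k<M. dst (S i) (y i k) z < e \<and> dst (S i) z (y i k) < e \<and> (z = base (S i) \<longrightarrow> k = 0)"
    \<comment> \<open>The detour through the base point is bounded independently of
      \<open>i\<close>: reversibility controls the leg towards the base point, \<open>R l\<close>
      the leg away from it.\<close>
    have bound: "\<bar>dst (S i) (y i k) (y i l)\<bar> \<le> \<Theta> (R k) * R k + R l" for i k l
    proof -
      interpret S: locally_reversible "points (S i)" "dst (S i)" "base (S i)" \<Theta>
        by (rule forward_spaces_locally_reversible[OF S assms(1)])
      have 0: "0 \<le> dst (S i) (base (S i)) (y i k)" using S.nonneg S.base_in y by blast
      then have Rk: "0 < R k" using R[of i k] by linarith
      have "dst (S i) (y i k) (base (S i)) \<le> \<Theta> (R k) * dst (S i) (base (S i)) (y i k)"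
        using Rk R y S.base_in S.dist_self[OF S.base_in] by (intro S.rev) auto
      also have "\<dots> \<le> \<Theta> (R k) * R k"
        using R[of i k] S.Theta[OF Rk] by (intro mult_left_mono) auto
      finally show ?thesis
        using S.triangle[OF y(2) S.base_in y(2), of k l] R[of i l] S.nonneg[OF y(2) y(2), of k l]
        by linarith
    qed
    \<comment> \<open>Pairs of indices form a countable type, so one diagonal extraction handles all
      distances at once.\<close>
    define D where "D i kl = dst (S i) (y i (fst kl)) (y i (snd kl))" for i kl
    have "\<bar>D i kl\<bar> \<le> \<Theta> (R (fst kl)) * R (fst kl) + R (snd kl)" for i kl
      unfolding D_def by (rule bound)
    from pointwise_bounded_convergent_subsequence[of D, OF this]
    obtain \<phi> \<delta> where \<phi>: "strict_mono \<phi>" and lim': "\<And>kl. (\<lambda>n. D (\<phi> n) kl) \<longlonglongrightarrow> \<delta> kl"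
      by blast
    have lim: "(\<lambda>n. dst ((S \<circ> \<phi>) n) ((y \<circ> \<phi>) n k) ((y \<circ> \<phi>) n l)) \<longlonglongrightarrow> curry \<delta> k l" for k l
      using lim'[of "(k, l)"] by (simp add: D_def)
    have nets_\<phi>: "\<exists>M. \<forall>i. \<forall>z\<in>base_ball ((S \<circ> \<phi>) i) r.
         \<exists>k<M. dst ((S \<circ> \<phi>) i) ((y \<circ> \<phi>) i k) z < e \<and> dst ((S \<circ> \<phi>) i) z ((y \<circ> \<phi>) i k) < e \<and>
           (z = base ((S \<circ> \<phi>) i) \<longrightarrow> k = 0)" if "0 < r" "0 < e" for r e
      using nets[OF that] by (auto simp: o_def)
    have S\<phi>: "(S \<circ> \<phi>) i \<in> forward_spaces \<Theta>" and y\<phi>: "(y \<circ> \<phi>) i 0 = base ((S \<circ> \<phi>) i)"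
      "(y \<circ> \<phi>) i k \<in> points ((S \<circ> \<phi>) i)" for i k
      using S y by simp_all
    interpret N: quasi_pseudo_metric_nets "curry \<delta>" \<Theta>
    proof (rule limit_quasi_pseudo_metric_nets[of \<Theta> "S \<circ> \<phi>" "y \<circ> \<phi>"])
      fix r e :: real assume "0 < r" "0 < e"
      from nets_\<phi>[OF this] show "\<exists>M. \<forall>i. \<forall>z\<in>base_ball ((S \<circ> \<phi>) i) r.
         \<exists>k<M. dst ((S \<circ> \<phi>) i) ((y \<circ> \<phi>) i k) z < e \<and> dst ((S \<circ> \<phi>) i) z ((y \<circ> \<phi>) i k) < e"
        by meson
    qed (fact assms(1) S\<phi> y\<phi> lim)+
    obtain L :: "real pointed_space" and p where L: "L \<in> forward_spaces \<Theta>"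
      and p: "\<And>k. p k \<in> points L" "base L = p 0" "\<And>k l. dst L (p k) (p l) = curry \<delta> k l"
      and dense: "\<And>z e. z \<in> points L \<Longrightarrow> 0 < e \<Longrightarrow> \<exists>k. dst L (p k) z < e \<and> dst L z (p k) < e"
      by (rule N.completion_exists) blast
    have "forward_GH_converges \<Theta> (S \<circ> \<phi>) L"
    proof (rule forward_GH_converges_of_nets[where y = "y \<circ> \<phi>" and p = p])
      show "\<exists>M. \<forall>k. dst L (p 0) (p k) < r \<longrightarrow>
         (\<exists>l<M. dst L (p k) (p l) < e \<and> dst L (p l) (p k) < e)" if "0 < r" "0 < e" for r e
        unfolding p(3) using that by (rule N.nets)
      show "(\<lambda>n. dst ((S \<circ> \<phi>) n) ((y \<circ> \<phi>) n k) ((y \<circ> \<phi>) n l)) \<longlonglongrightarrow> dst L (p k) (p l)" for k l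
        unfolding p(3) by (rule lim)
    qed (fact assms(1) S\<phi> L y\<phi> p(1,2) nets_\<phi> dense)+
    then show "\<exists>\<phi> (L :: real pointed_space). strict_mono \<phi> \<and> L \<in> forward_spaces \<Theta> \<and>
        forward_GH_converges \<Theta> (S \<circ> \<phi>) L"
      using \<phi> L by blast
  qed (use S cov in auto)
qed

end
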